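(* Let $f:\mathbb{R}^n\to\mathbb{R}^n$, $g:\mathbb{R}^n\to\mathbb{R}^{n\times m}$, $J:\mathbb{R}^n\to\mathbb{R}^{n\times d}$ have polynomial entries. Let $\mathbb{U}=\{u\in\mathbb{R}^m : c_{u,i}(u)\le 0,\ i=1,\dots,l_u\}$ be compact, where each $c_{u,i}$ is a convex polynomial, and suppose there is $u_0$ with $c_{u,i}(u_0)<0$ for all $i$. Let $M_\epsilon\ge 0$, let $\Theta\subseteq\mathbb{R}^k$ be a compact semialgebraic set, and let $b(x,\theta)$ be a polynomial in $(x,\theta)\in\mathbb{R}^n\times\mathbb{R}^k$ such that for every $\theta\in\Theta$ the set $\{x\in\mathbb{R}^n : b(x,\theta)\ge 0\}$ is compact. For $\theta\in\Theta$ define $$V(\theta)=\min_{x:\ b(x,\theta)=0}\ \max_{u\in\mathbb{U}}\ \min_{\|\epsilon\|\le M_\epsilon}\ \big[L_fb(x,\theta)+L_gb(x,\theta)\,u+L_Jb(x,\theta)\,\epsilon\big].$$ Then for every $\theta\in\Theta$, $V(\theta)$ equals the optimal value, denoted $P(\theta)$, of the single-level polynomial optimization problem in the variables $x\in\mathbb{R}^n$, $z\in\mathbb{R}$, $u\in\mathbb{R}^m$, $\zeta\in\mathbb{R}^{l_u}$: $$P(\theta)=\min_{x,z,u,\zeta}\ L_fb(x,\theta)+L_gb(x,\theta)\,u-M_\epsilon z$$ subject to $$z^2=\|L_Jb(x,\theta)\|^2,\qquad b(x,\theta)=0,\qquad (u,\zeta)\in\mathbb{K}(x,\theta).$$ Consequently,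 the problem of maximizing $V(\theta)$ over $\theta\in\Theta$ is equivalent (same optimal value and same set of maximizers) to the max-min polynomial optimization problem $\max_{\theta\in\Theta}P(\theta)$, that is, $$\max_{\theta\in\Theta}\ \min_{x,z,u,\zeta}\Big\{L_fb(x,\theta)+L_gb(x,\theta)\,u-M_\epsilon z \ :\ z^2=\|L_Jb(x,\theta)\|^2,\ b(x,\theta)=0,\ (u,\zeta)\in\mathbb{K}(x,\theta)\Big\}.$$
   Context: Here $\|\cdot\|$ is the Euclidean norm. The underlying control system is $\dot x=f(x)+g(x)u+J(x)\epsilon$ with state $x\in\mathbb{R}^n$, control $u\in\mathbb{U}$ and unknown disturbance $\epsilon\in\mathbb{R}^d$, $\|\epsilon\|\le M_\epsilon$. Notation: $\frac{\partial b}{\partial x}(x,\theta)$ is the gradient with respect to $x$ as a row vector; $L_fb(x,\theta)=\frac{\partial b}{\partial x}(x,\theta)f(x)\in\mathbb{R}$, $L_gb(x,\theta)=\frac{\partial b}{\partial x}(x,\theta)g(x)\in\mathbb{R}^{1\times m}$, $L_Jb(x,\theta)=\frac{\partial b}{\partial x}(x,\theta)J(x)\in\mathbb{R}^{1\times d}$. The set $\mathbb{K}(x,\theta)\subseteq\mathbb{R}^m\times\mathbb{R}^{l_u}$ is the set of all pairs $(u,\zeta)$ satisfying the following Karush–Kuhn–Tucker (KKT) conditions of the problem $\max_{u\in\mathbb{U}}L_gb(x,\theta)u$, which are polynomial (in)equalities: $c_{u,i}(u)\le 0$ for $i=1,\dots,l_u$; $\zeta_i\ge 0$ for $i=1,\dots,l_u$;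 $-L_gb(x,\theta)+\sum_{i=1}^{l_u}\zeta_i\frac{\partial c_{u,i}}{\partial u}(u)=0$; $\zeta_i c_{u,i}(u)=0$ for $i=1,\dots,l_u$. A minimum over an empty set is taken to be $+\infty$ (this occurs on both sides simultaneously, when $\{x: b(x,\theta)=0\}=\emptyset$). *)

theory Defs
  imports "HOL-Analysis.Analysis"
begin

text \<open>The gradient as a row vector of partial derivatives. It is only applied to polynomials,
  where the derivative exists.\<close>

definition gradient :: "(real ^ 'n \<Rightarrow> real) \<Rightarrow> real ^ 'n \<Rightarrow> real ^ 'n"
  where "gradient h x = (\<chi> i. frechet_derivative h (at x) (axis i 1))"

definition lie_vec ::
  "(real ^ 'n \<Rightarrow> real ^ 'k \<Rightarrow> real) \<Rightarrow> (real ^ 'n \<Rightarrow> real ^ 'n) \<Rightarrow> real ^ 'n \<Rightarrow> real ^ 'k \<Rightarrow> real"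
  where "lie_vec b f x \<theta> = gradient (\<lambda>y. b y \<theta>) x \<bullet> f x"

text \<open>A matrix in \<open>\<real>\<^bsup>n\<times>p\<^esup>\<close> has type \<open>real ^ 'p ^ 'n\<close>; the result is the row vector
  \<open>\<partial>b/\<partial>x G(x)\<close> in \<open>\<real>\<^bsup>1\<times>p\<^esup>\<close>.\<close>

definition lie_mat ::
  "(real ^ 'n \<Rightarrow> real ^ 'k \<Rightarrow> real) \<Rightarrow> (real ^ 'n \<Rightarrow> real ^ 'p ^ 'n) \<Rightarrow> real ^ 'n \<Rightarrow> real ^ 'k \<Rightarrow> real ^ 'p"
  where "lie_mat b G x \<theta> = gradient (\<lambda>y. b y \<theta>) x v* G x"

text \<open>The semialgebraic sets: the smallest Boolean algebra of sets containing all
  \<open>{x. p x > 0}\<close> with \<open>p\<close> polynomial.\<close>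

inductive semialgebraic :: "'a::real_normed_vector set \<Rightarrow> bool"
  where
    pos: "real_polynomial_function p \<Longrightarrow> semialgebraic {x. p x > 0}"
  | compl: "semialgebraic A \<Longrightarrow> semialgebraic (- A)"
  | union: "semialgebraic A \<Longrightarrow> semialgebraic B \<Longrightarrow> semialgebraic (A \<union> B)"

definition control_set :: "('l \<Rightarrow> real ^ 'm \<Rightarrow> real) \<Rightarrow> (real ^ 'm) set"
  where "control_set c = {u. \<forall>i. c i u \<le> 0}"

text \<open>Optimal values are infima and suprema in the extended reals, so that a minimum over the
  empty set is \<open>\<infinity>\<close>. That they are attained is part of the theorem.\<close>

definition worst_rate ::
  "(real ^ 'n \<Rightarrow> real ^ 'n) \<Rightarrow> (real ^ 'n \<Rightarrow> real ^ 'm ^ 'n) \<Rightarrow> (real ^ 'n \<Rightarrow> real ^ 'd ^ 'n) \<Rightarrow> real \<Rightarrow>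
   (real ^ 'n \<Rightarrow> real ^ 'k \<Rightarrow> real) \<Rightarrow> real ^ 'k \<Rightarrow> real ^ 'n \<Rightarrow> real ^ 'm \<Rightarrow> ereal"
  where "worst_rate f g J M b \<theta> x u =
    (INF \<epsilon>\<in>{\<epsilon>. norm \<epsilon> \<le> M}. ereal (lie_vec b f x \<theta> + lie_mat b g x \<theta> \<bullet> u + lie_mat b J x \<theta> \<bullet> \<epsilon>))"

definition best_rate ::
  "(real ^ 'n \<Rightarrow> real ^ 'n) \<Rightarrow> (real ^ 'n \<Rightarrow> real ^ 'm ^ 'n) \<Rightarrow> (real ^ 'n \<Rightarrow> real ^ 'd ^ 'n) \<Rightarrow>
   ('l \<Rightarrow> real ^ 'm \<Rightarrow> real) \<Rightarrow> real \<Rightarrow>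
   (real ^ 'n \<Rightarrow> real ^ 'k \<Rightarrow> real) \<Rightarrow> real ^ 'k \<Rightarrow> real ^ 'n \<Rightarrow> ereal"
  where "best_rate f g J c M b \<theta> x = (SUP u\<in>control_set c. worst_rate f g J M b \<theta> x u)"

definition V_value ::
  "(real ^ 'n \<Rightarrow> real ^ 'n) \<Rightarrow> (real ^ 'n \<Rightarrow> real ^ 'm ^ 'n) \<Rightarrow> (real ^ 'n \<Rightarrow> real ^ 'd ^ 'n) \<Rightarrow>
   ('l \<Rightarrow> real ^ 'm \<Rightarrow> real) \<Rightarrow> real \<Rightarrow> (real ^ 'n \<Rightarrow> real ^ 'k \<Rightarrow> real) \<Rightarrow> real ^ 'k \<Rightarrow> ereal"
  where "V_value f g J c M b \<theta> = (INF x\<in>{x. b x \<theta> = 0}. best_rate f g J c M b \<theta> x)"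

definition kkt_set ::
  "(real ^ 'n \<Rightarrow> real ^ 'm ^ 'n) \<Rightarrow> ('l::finite \<Rightarrow> real ^ 'm \<Rightarrow> real) \<Rightarrow>
   (real ^ 'n \<Rightarrow> real ^ 'k \<Rightarrow> real) \<Rightarrow> real ^ 'n \<Rightarrow> real ^ 'k \<Rightarrow> ((real ^ 'm) \<times> (real ^ 'l)) set"
  where "kkt_set g c b x \<theta> = {(u, \<zeta>).
    (\<forall>i. c i u \<le> 0) \<and>
    (\<forall>i. \<zeta> $ i \<ge> 0) \<and>
    - lie_mat b g x \<theta> + (\<Sum>i\<in>UNIV. \<zeta> $ i *\<^sub>R gradient (c i) u) = 0 \<and>
    (\<forall>i. \<zeta> $ i * c i u = 0)}"

definition P_objective ::
  "(real ^ 'n \<Rightarrow> real ^ 'n) \<Rightarrow> (real ^ 'n \<Rightarrow> real ^ 'm ^ 'n) \<Rightarrow> real \<Rightarrow>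
   (real ^ 'n \<Rightarrow> real ^ 'k \<Rightarrow> real) \<Rightarrow> real ^ 'k \<Rightarrow>
   (real ^ 'n) \<times> real \<times> (real ^ 'm) \<times> (real ^ 'l) \<Rightarrow> real"
  where "P_objective f g M b \<theta> = (\<lambda>(x, z, u, \<zeta>). lie_vec b f x \<theta> + lie_mat b g x \<theta> \<bullet> u - M * z)"

definition P_feasible ::
  "(real ^ 'n \<Rightarrow> real ^ 'm ^ 'n) \<Rightarrow> (real ^ 'n \<Rightarrow> real ^ 'd ^ 'n) \<Rightarrow>
   ('l::finite \<Rightarrow> real ^ 'm \<Rightarrow> real) \<Rightarrow> (real ^ 'n \<Rightarrow> real ^ 'k \<Rightarrow> real) \<Rightarrow> real ^ 'k \<Rightarrow>
   ((real ^ 'n) \<times> real \<times> (real ^ 'm) \<times> (real ^ 'l)) set"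
  where "P_feasible g J c b \<theta> = {(x, z, u, \<zeta>).
    z\<^sup>2 = (norm (lie_mat b J x \<theta>))\<^sup>2 \<and> b x \<theta> = 0 \<and> (u, \<zeta>) \<in> kkt_set g c b x \<theta>}"

definition P_value ::
  "(real ^ 'n \<Rightarrow> real ^ 'n) \<Rightarrow> (real ^ 'n \<Rightarrow> real ^ 'm ^ 'n) \<Rightarrow> (real ^ 'n \<Rightarrow> real ^ 'd ^ 'n) \<Rightarrow>
   ('l::finite \<Rightarrow> real ^ 'm \<Rightarrow> real) \<Rightarrow> real \<Rightarrow> (real ^ 'n \<Rightarrow> real ^ 'k \<Rightarrow> real) \<Rightarrow> real ^ 'k \<Rightarrow> ereal"
  where "P_value f g J c M b \<theta> = (INF p\<in>P_feasible g J c b \<theta>. ereal (P_objective f g M b \<theta> p))"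

text \<open>The objective and all constraint functions of the single-level problem are polynomial,
  jointly in the parameter and the decision variables.\<close>

definition P_polynomial ::
  "(real ^ 'n \<Rightarrow> real ^ 'n) \<Rightarrow> (real ^ 'n \<Rightarrow> real ^ 'm ^ 'n) \<Rightarrow> (real ^ 'n \<Rightarrow> real ^ 'd ^ 'n) \<Rightarrow>
   ('l::finite \<Rightarrow> real ^ 'm \<Rightarrow> real) \<Rightarrow> real \<Rightarrow> (real ^ 'n \<Rightarrow> real ^ 'k \<Rightarrow> real) \<Rightarrow> bool"
  where "P_polynomial f g J c M b \<longleftrightarrow>
    (let poly = (\<lambda>q :: real ^ 'k \<Rightarrow> real ^ 'n \<Rightarrow> real \<Rightarrow> real ^ 'm \<Rightarrow> real ^ 'l \<Rightarrow> real.
           real_polynomial_function (\<lambda>(\<theta>, x, z, u, \<zeta>). q \<theta> x z u \<zeta>))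
     in poly (\<lambda>\<theta> x z u \<zeta>. P_objective f g M b \<theta> (x, z, u, \<zeta>)) \<and>
        poly (\<lambda>\<theta> x z u \<zeta>. z\<^sup>2 - (norm (lie_mat b J x \<theta>))\<^sup>2) \<and>
        poly (\<lambda>\<theta> x z u \<zeta>. b x \<theta>) \<and>
        (\<forall>i. poly (\<lambda>\<theta> x z u \<zeta>. c i u)) \<and>
        (\<forall>i. poly (\<lambda>\<theta> x z u \<zeta>. \<zeta> $ i)) \<and>
        (\<forall>j. poly (\<lambda>\<theta> x z u \<zeta>.
          (- lie_mat b g x \<theta> + (\<Sum>i\<in>UNIV. \<zeta> $ i *\<^sub>R gradient (c i) u)) $ j)) \<and>
        (\<forall>i. poly (\<lambda>\<theta> x z u \<zeta>. \<zeta> $ i * c i u)))"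

end

theory Submission
  imports Defs
begin

text \<open>By Cauchy-Schwarz the worst disturbance contributes \<open>- M \<parallel>L\<^sub>Jb\<parallel>\<close>, and of the two solutions
  of \<open>z\<^sup>2 = \<parallel>L\<^sub>Jb\<parallel>\<^sup>2\<close> the minimization over \<open>z\<close> picks the nonnegative one. Under Slater's condition
  the KKT points of the convex inner problem are exactly its maximizers, so every KKT pair over \<open>x\<close>
  carries the inner maximum. That maximum is the support function of the control set at \<open>L\<^sub>gb\<close>,
  which is convex, hence continuous, so the outer minimum over the compact zero set is attained.\<close>

section \<open>Gradients, and polynomiality of the single-level problem\<close>

text \<open>The derivative is linear, so its values on the basis vectors determine it, and these are
  the components of the gradient.\<close>

lemma has_derivative_gradient:
  assumes "h differentiable (at x)"
  shows "(h has_derivative (\<lambda>v. gradient h x \<bullet> v)) (at x)"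
proof -
  let ?D = "frechet_derivative h (at x)"
  have D: "(h has_derivative ?D) (at x)"
    using assms frechet_derivative_works by blast
  interpret D: linear ?D
    using assms by (rule linear_frechet_derivative)
  have "?D = (\<lambda>v. gradient h x \<bullet> v)"
  proof
    fix v
    have "?D v = ?D (\<Sum>i\<in>UNIV. v $ i *\<^sub>R axis i 1)"
      using basis_expansion[of v] by (simp add: scalar_mult_eq_scaleR)
    also have "\<dots> = gradient h x \<bullet> v"
      by (simp add: D.sum D.scaleR gradient_def inner_vec_def mult.commute)
    finally show "?D v = gradient h x \<bullet> v" .
  qed
  with D show ?thesis by simp
qed

text \<open>With the direction \<open>v\<close> fixed, a linear map has the constant derivative
  \<open>h v\<close>, and the sum and product rules stay within polynomials in
  \<open>x\<close>.\<close>

lemma real_polynomial_function_frechet_derivative: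
  fixes p :: "'a::real_normed_vector \<Rightarrow> real"
  assumes "real_polynomial_function p"
  shows "real_polynomial_function (\<lambda>x. frechet_derivative p (at x) v)"
  using assms
proof induction
  case (linear h)
  have "frechet_derivative h (at x) = h" for x
    using linear bounded_linear_imp_has_derivative frechet_derivative_at by metis
  then show ?case by auto
next
  case (const c)
  have "frechet_derivative (\<lambda>x. c) (at x) = (\<lambda>v. 0)" for x :: 'a
    by (metis frechet_derivative_at has_derivative_const)
  then show ?case by auto
next
  case (add p q)
  have "frechet_derivative (\<lambda>x. p x + q x) (at x) =
      (\<lambda>v. frechet_derivative p (at x) v + frechet_derivative q (at x) v)" for x
    by (rule frechet_derivative_at[symmetric], intro has_derivative_add)
      (use add.hyps differentiable_at_real_polynomial_function frechet_derivative_works in blast)+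
  then show ?case using add.IH by auto
next
  case (mult p q)
  have "frechet_derivative (\<lambda>x. p x * q x) (at x) =
      (\<lambda>v. p x * frechet_derivative q (at x) v + frechet_derivative p (at x) v * q x)" for x
    by (rule frechet_derivative_at[symmetric], intro has_derivative_mult)
      (use mult.hyps differentiable_at_real_polynomial_function frechet_derivative_works in blast)+
  then show ?case using mult by auto
qed

text \<open>Serves to lift a polynomial in some of the variables to all of them, by composing with a
  projection.\<close>

lemma real_polynomial_function_bounded_linear_compose:
  assumes "real_polynomial_function p" "bounded_linear L"
  shows "real_polynomial_function (\<lambda>x. p (L x))"
  using real_polynomial_function_compose[OF polynomial_function_bounded_linear[OF assms(2)] assms(1)]
  by (simp add: o_def)

lemma real_polynomial_function_gradient:
  assumes "real_polynomial_function h"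
  shows "real_polynomial_function (\<lambda>x. gradient h x $ i)"
  using real_polynomial_function_frechet_derivative[OF assms] by (simp add: gradient_def)

text \<open>By the chain rule along \<open>\<lambda>y. (y, \<theta>)\<close>, the derivative in
  \<open>x\<close> alone is the joint derivative in the directions \<open>(v, 0)\<close>, and that
  is polynomial in both arguments.\<close>

lemma real_polynomial_function_partial_gradient:
  fixes b :: "real ^ 'n \<Rightarrow> real ^ 'k \<Rightarrow> real"
  assumes "real_polynomial_function (\<lambda>(x, \<theta>). b x \<theta>)"
  shows "real_polynomial_function (\<lambda>(x, \<theta>). gradient (\<lambda>y. b y \<theta>) x $ i)"
proof -
  let ?B = "\<lambda>(x, \<theta>). b x \<theta>"
  have "frechet_derivative (\<lambda>y. b y \<theta>) (at x) v = frechet_derivative ?B (at (x, \<theta>)) (v, 0)"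
    for x \<theta> v
  proof -
    have 1: "((\<lambda>y. (y, \<theta>)) has_derivative (\<lambda>v. (v, 0))) (at x)"
      by (intro derivative_intros)
    have 2: "(?B has_derivative frechet_derivative ?B (at (x, \<theta>))) (at (x, \<theta>))"
      using assms differentiable_at_real_polynomial_function frechet_derivative_works by blast
    have "((\<lambda>y. b y \<theta>) has_derivative (\<lambda>v. frechet_derivative ?B (at (x, \<theta>)) (v, 0))) (at x)"
      using diff_chain_at[OF 1 2] by (simp add: o_def)
    from frechet_derivative_at[OF this] show ?thesis by metis
  qed
  then show ?thesis
    using real_polynomial_function_frechet_derivative[OF assms, of "(axis i 1, 0)"]
    by (simp add: gradient_def case_prod_beta')
qed

lemma real_polynomial_function_lie_vec:
  assumes "real_polynomial_function (\<lambda>(x, \<theta>). b x \<theta>)"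
    and "\<And>i. real_polynomial_function (\<lambda>x. f x $ i)"
  shows "real_polynomial_function (\<lambda>(x, \<theta>). lie_vec b f x \<theta>)"
proof -
  have "real_polynomial_function (\<lambda>p. f (fst p) $ i)" for i
    using assms(2) bounded_linear_fst by (rule real_polynomial_function_bounded_linear_compose)
  then show ?thesis
    using real_polynomial_function_partial_gradient[OF assms(1)]
    unfolding lie_vec_def inner_vec_def inner_real_def case_prod_beta'
    by (intro real_polynomial_function_sum real_polynomial_function.intros(4)) auto
qed

lemma real_polynomial_function_lie_mat:
  assumes "real_polynomial_function (\<lambda>(x, \<theta>). b x \<theta>)"
    and "\<And>i j. real_polynomial_function (\<lambda>x. G x $ i $ j)"
  shows "real_polynomial_function (\<lambda>(x, \<theta>). lie_mat b G x \<theta> $ j)"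
proof -
  have "real_polynomial_function (\<lambda>p. G (fst p) $ i $ j)" for i
    using assms(2) bounded_linear_fst by (rule real_polynomial_function_bounded_linear_compose)
  then show ?thesis
    using real_polynomial_function_partial_gradient[OF assms(1)]
    unfolding lie_mat_def vector_matrix_mult_def vec_lambda_beta case_prod_beta'
    by (intro real_polynomial_function_sum real_polynomial_function.intros(4)) auto
qed

lemma P_polynomial_of_polynomial_data:
  fixes f :: "real ^ 'n \<Rightarrow> real ^ 'n"
    and g :: "real ^ 'n \<Rightarrow> real ^ 'm ^ 'n"
    and J :: "real ^ 'n \<Rightarrow> real ^ 'd ^ 'n"
    and c :: "'l::finite \<Rightarrow> real ^ 'm \<Rightarrow> real"
    and b :: "real ^ 'n \<Rightarrow> real ^ 'k \<Rightarrow> real"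
  assumes f: "\<And>i. real_polynomial_function (\<lambda>x. f x $ i)"
    and g: "\<And>i j. real_polynomial_function (\<lambda>x. g x $ i $ j)"
    and J: "\<And>i j. real_polynomial_function (\<lambda>x. J x $ i $ j)"
    and c: "\<And>i. real_polynomial_function (c i)"
    and b: "real_polynomial_function (\<lambda>(x, \<theta>). b x \<theta>)"
  shows "P_polynomial f g J c M b"
proof -
  \<comment> \<open>The tuple lists the parameter before the state, whereas \<open>b\<close> and the
    Lie derivatives take the state first; hence the swap.\<close>
  define \<theta>x where "\<theta>x = (\<lambda>p :: (real ^ 'k) \<times> (real ^ 'n) \<times> real \<times> (real ^ 'm) \<times> (real ^ 'l).
    (fst (snd p), fst p))"
  note bl = bounded_linear_fst_comp bounded_linear_snd_comp bounded_linear_ident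
  have \<theta>x: "bounded_linear \<theta>x"
    unfolding \<theta>x_def by (intro bounded_linear_Pair bl)
  have z: "real_polynomial_function (\<lambda>p :: (real ^ 'k) \<times> (real ^ 'n) \<times> real \<times> (real ^ 'm) \<times> (real ^ 'l).
      fst (snd (snd p)))"
    by (intro real_polynomial_function.intros(1) bl)
  have u_lin: "bounded_linear (\<lambda>p :: (real ^ 'k) \<times> (real ^ 'n) \<times> real \<times> (real ^ 'm) \<times> (real ^ 'l).
      fst (snd (snd (snd p))))"
    by (intro bl)
  have u: "real_polynomial_function (\<lambda>p :: (real ^ 'k) \<times> (real ^ 'n) \<times> real \<times> (real ^ 'm) \<times> (real ^ 'l).
      fst (snd (snd (snd p))) $ j)" for j
    by (intro real_polynomial_function.intros(1) bounded_linear_compose[OF bounded_linear_vec_nth] bl)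
  have \<zeta>: "real_polynomial_function (\<lambda>p :: (real ^ 'k) \<times> (real ^ 'n) \<times> real \<times> (real ^ 'm) \<times> (real ^ 'l).
      snd (snd (snd (snd p))) $ i)" for i
    by (intro real_polynomial_function.intros(1) bounded_linear_compose[OF bounded_linear_vec_nth] bl)
  note cu = real_polynomial_function_bounded_linear_compose[OF c u_lin]
  note gcu = real_polynomial_function_bounded_linear_compose
    [OF real_polynomial_function_gradient[OF c] u_lin]
  note lb = real_polynomial_function_bounded_linear_compose[OF b \<theta>x, unfolded \<theta>x_def prod.case]
  note lf = real_polynomial_function_bounded_linear_compose
    [OF real_polynomial_function_lie_vec[OF b f] \<theta>x, unfolded \<theta>x_def prod.case]
  note lg = real_polynomial_function_bounded_linear_compose
    [OF real_polynomial_function_lie_mat[OF b g] \<theta>x, unfolded \<theta>x_def prod.case]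
  note lJ = real_polynomial_function_bounded_linear_compose
    [OF real_polynomial_function_lie_mat[OF b J] \<theta>x, unfolded \<theta>x_def prod.case]
  \<comment> \<open>The squared norm is unfolded to a sum of squared components, since the norm
    itself is in general not polynomial.\<close>
  show ?thesis
    unfolding P_polynomial_def Let_def P_objective_def case_prod_beta' prod.sel power2_norm_eq_inner
      inner_vec_def inner_real_def vector_add_component vector_uminus_component sum_component
      vector_scaleR_component real_scaleR_def fst_conv snd_conv
    by (intro conjI allI real_polynomial_function_diff real_polynomial_function.intros(3)
        real_polynomial_function_sum real_polynomial_function.intros(4) real_polynomial_function_minus
        real_polynomial_function_power real_polynomial_function.intros(2)
        z u \<zeta> cu gcu lb lf lg lJ finite)
qed

section \<open>Convex optimality: tangents, multipliers and KKT points\<close>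

text \<open>Along the line through \<open>x\<close> and \<open>y\<close>, \<open>h\<close> becomes a
  convex function of one real variable with slope \<open>D (y - x)\<close> at 0, and such a function
  lies above its tangent.\<close>

lemma convex_on_above_derivative:
  fixes h :: "'a::real_normed_vector \<Rightarrow> real"
  assumes "convex_on UNIV h" "(h has_derivative D) (at x)"
  shows "h x + D (y - x) \<le> h y"
proof -
  define \<phi> where "\<phi> t = h (x + t *\<^sub>R (y - x))" for t
  interpret D: bounded_linear D
    using assms(2) by (rule has_derivative_bounded_linear)
  have "convex_on UNIV \<phi>"
  proof (rule convex_onI)
    fix t r s :: real
    assume t: "0 < t" "t < 1"
    have "x + ((1 - t) *\<^sub>R r + t *\<^sub>R s) *\<^sub>R (y - x) =
        (1 - t) *\<^sub>R (x + r *\<^sub>R (y - x)) + t *\<^sub>R (x + s *\<^sub>R (y - x))"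
      by (simp add: algebra_simps)
    then show "\<phi> ((1 - t) *\<^sub>R r + t *\<^sub>R s) \<le> (1 - t) * \<phi> r + t * \<phi> s"
      using convex_onD[OF assms(1), of t] t by (simp add: \<phi>_def)
  qed simp
  moreover have "(\<phi> has_real_derivative D (y - x)) (at 0)"
  proof -
    have 1: "((\<lambda>t. x + t *\<^sub>R (y - x)) has_derivative (\<lambda>t. t *\<^sub>R (y - x))) (at 0)"
      by (auto intro!: derivative_eq_intros)
    have "(\<phi> has_derivative (\<lambda>t. D (t *\<^sub>R (y - x)))) (at 0)"
      using diff_chain_at[OF 1, of h D] assms(2) by (simp add: o_def \<phi>_def[abs_def])
    then show ?thesis
      by (simp add: has_field_derivative_def D.scaleR mult_commute_abs)
  qed
  ultimately have "\<phi> 1 - \<phi> 0 \<ge> D (y - x) * (1 - 0)"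
    by (intro convex_on_imp_above_tangent[of UNIV]) auto
  then show ?thesis by (simp add: \<phi>_def)
qed

text \<open>The hyperplane separates the origin from the pairs \<open>(t, s)\<close> such that some \<open>u\<close> gains more
  than \<open>t\<close> over \<open>v\<close> while violating each constraint \<open>i\<close> by at most \<open>s\<^sub>i\<close>; Slater's condition makes
  its first coordinate nonzero.\<close>

lemma convex_lagrange_multipliers:
  fixes c :: "'l::finite \<Rightarrow> 'a::euclidean_space \<Rightarrow> real"
  assumes conv: "\<And>i. convex_on UNIV (c i)"
    and slater: "\<And>i. c i u\<^sub>0 < 0"
    and max: "\<And>u. (\<And>i. c i u \<le> 0) \<Longrightarrow> w \<bullet> u \<le> w \<bullet> v"
  shows "\<exists>\<zeta> :: real ^ 'l. (\<forall>i. \<zeta> $ i \<ge> 0) \<and>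
    (\<forall>u. w \<bullet> u - (\<Sum>i\<in>UNIV. \<zeta> $ i * c i u) \<le> w \<bullet> v)"
proof -
  define S where "S = {(t :: real, s :: real ^ 'l). \<exists>u. t < w \<bullet> u - w \<bullet> v \<and> (\<forall>i. c i u \<le> s $ i)}"
  have "convex S"
  proof (rule convexI)
    fix p q :: "real \<times> (real ^ 'l)" and r s :: real
    assume p: "p \<in> S" and q: "q \<in> S" and rs: "0 \<le> r" "0 \<le> s" "r + s = 1"
    obtain u where u: "fst p < w \<bullet> u - w \<bullet> v" "\<And>i. c i u \<le> snd p $ i"
      using p by (auto simp: S_def)
    obtain y where y: "fst q < w \<bullet> y - w \<bullet> v" "\<And>i. c i y \<le> snd q $ i"
      using q by (auto simp: S_def)
    \<comment> \<open>Strictness has to come from a summand of positive weight: the first if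
      \<open>r\<close> is nonzero, otherwise the second, whose weight is then 1.\<close>
    have "r * fst p + s * fst q < r * (w \<bullet> u - w \<bullet> v) + s * (w \<bullet> y - w \<bullet> v)"
    proof (cases "r = 0")
      case True
      then show ?thesis using y(1) rs by simp
    next
      case False
      then show ?thesis
        using u(1) y(1) rs by (intro add_less_le_mono mult_strict_left_mono mult_left_mono) auto
    qed
    also have "\<dots> = w \<bullet> (r *\<^sub>R u + s *\<^sub>R y) - (r + s) * (w \<bullet> v)"
      by (simp add: algebra_simps)
    finally have "r * fst p + s * fst q < w \<bullet> (r *\<^sub>R u + s *\<^sub>R y) - w \<bullet> v"
      using rs(3) by simp
    moreover have "c i (r *\<^sub>R u + s *\<^sub>R y) \<le> r * snd p $ i + s * snd q $ i" for i
    proof -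
      have "c i (r *\<^sub>R u + s *\<^sub>R y) \<le> r * c i u + s * c i y"
        using conv[of i] rs by (simp add: convex_on_def)
      also have "\<dots> \<le> r * snd p $ i + s * snd q $ i"
        using u(2) y(2) rs by (intro add_mono mult_left_mono) auto
      finally show ?thesis .
    qed
    ultimately show "r *\<^sub>R p + s *\<^sub>R q \<in> S"
      by (auto simp: S_def case_prod_beta')
  qed
  \<comment> \<open>Because of the strict inequality in \<open>S\<close>, the origin would give a
    feasible point strictly better than \<open>v\<close>.\<close>
  moreover have "0 \<notin> S"
    using max by (fastforce simp: S_def zero_prod_def)
  ultimately obtain a where a: "a \<noteq> 0" "\<And>p. p \<in> S \<Longrightarrow> 0 \<le> a \<bullet> p"
    using separating_hyperplane_set_0 by metis
  obtain a\<^sub>0 \<alpha> where a_eq: "a = (a\<^sub>0, \<alpha>)" by fastforce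
  have a_nz: "a\<^sub>0 \<noteq> 0 \<or> \<alpha> \<noteq> 0"
    using a(1) by (auto simp: a_eq zero_prod_def)
  have sep: "0 \<le> a\<^sub>0 * t + \<alpha> \<bullet> s" if "t < w \<bullet> u - w \<bullet> v" "\<And>i. c i u \<le> s $ i" for t u s
    using a(2)[of "(t, s)"] that by (auto simp: a_eq S_def)
  define C where "C u = (\<chi> i. c i u)" for u
  \<comment> \<open>In \<open>S\<close> the first coordinate may decrease without bound. The bound
    -1 keeps \<open>t\<close> below the gain 0 of \<open>v\<close>; the other term pushes the
    functional down to -1 or less.\<close>
  have a0_le: "a\<^sub>0 \<le> 0"
  proof (rule ccontr)
    assume a0: "\<not> a\<^sub>0 \<le> 0"
    define t where "t = min (- 1) (- (\<alpha> \<bullet> C v + 1) / a\<^sub>0)"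
    have "0 \<le> a\<^sub>0 * t + \<alpha> \<bullet> C v"
      by (rule sep[of _ v]) (auto simp: t_def C_def)
    moreover have "a\<^sub>0 * t \<le> a\<^sub>0 * (- (\<alpha> \<bullet> C v + 1) / a\<^sub>0)"
      using a0 by (intro mult_left_mono) (auto simp: t_def)
    ultimately show False using a0 by simp
  qed
  \<comment> \<open>\<open>S\<close> is closed under raising any \<open>s $ i\<close>. If \<alpha>
    had a negative component, a shift contributing \<open>- K\<close> would make the functional
    negative.\<close>
  have \<alpha>_ge: "\<alpha> $ i \<ge> 0" for i
  proof (rule ccontr)
    assume neg: "\<not> \<alpha> $ i \<ge> 0"
    define K where "K = \<bar>- a\<^sub>0 + \<alpha> \<bullet> C v\<bar> + 1"
    have "0 \<le> a\<^sub>0 * (- 1) + \<alpha> \<bullet> (C v + (K / - \<alpha> $ i) *\<^sub>R axis i 1)"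
      by (rule sep[of _ v]) (use neg in \<open>auto simp: C_def K_def axis_def divide_simps\<close>)
    also have "\<dots> = - a\<^sub>0 + \<alpha> \<bullet> C v - K"
      using neg by (simp add: inner_diff_right inner_axis)
    finally show False by (simp add: K_def)
  qed
  \<comment> \<open>Strictness keeps the exact gain of \<open>u\<close> out of \<open>S\<close>, so
    it is approached from below by \<open>d\<close>. The choice of \<open>d\<close> makes the error
    \<open>- a\<^sub>0 * d\<close> equal to \<open>e - d\<close>, hence less than
    \<open>e\<close>.\<close>
  have key: "0 \<le> a\<^sub>0 * (w \<bullet> u - w \<bullet> v) + \<alpha> \<bullet> C u" for u
  proof (rule field_le_epsilon)
    fix e :: real
    assume "0 < e"
    define d where "d = e / (1 - a\<^sub>0)"
    have d: "d > 0" using \<open>0 < e\<close> a0_le by (simp add: d_def)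
    have "0 \<le> a\<^sub>0 * (w \<bullet> u - w \<bullet> v - d) + \<alpha> \<bullet> C u"
      by (rule sep[of _ u]) (use d in \<open>auto simp: C_def\<close>)
    moreover have "e = (1 - a\<^sub>0) * d"
      using a0_le by (simp add: d_def)
    ultimately show "0 \<le> a\<^sub>0 * (w \<bullet> u - w \<bullet> v) + \<alpha> \<bullet> C u + e"
      using d by (simp add: algebra_simps)
  qed
  \<comment> \<open>Otherwise \<open>key\<close> at the Slater point makes a sum of nonpositive
    terms nonnegative; all terms vanish, so \<alpha> is zero as well, and the hyperplane
    degenerates.\<close>
  have "a\<^sub>0 \<noteq> 0"
  proof
    assume "a\<^sub>0 = 0"
    then have "0 \<le> (\<Sum>i\<in>UNIV. \<alpha> $ i * c i u\<^sub>0)"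
      using key[of u\<^sub>0] by (simp add: C_def inner_vec_def)
    moreover have "\<alpha> $ i * c i u\<^sub>0 \<le> 0" for i
      using \<alpha>_ge slater by (intro mult_nonneg_nonpos) (auto intro: less_imp_le)
    ultimately have "\<alpha> $ i * c i u\<^sub>0 = 0" for i
      using sum_nonneg_0[of UNIV "\<lambda>i. - (\<alpha> $ i * c i u\<^sub>0)" i] sum_nonpos[of UNIV "\<lambda>i. \<alpha> $ i * c i u\<^sub>0"]
      by (simp add: sum_negf)
    then have "\<alpha> $ i = 0" for i
      using slater[of i] by (metis less_irrefl mult_eq_0_iff)
    then show False
      using a_nz \<open>a\<^sub>0 = 0\<close> by (simp add: vec_eq_iff)
  qed
  then have a0: "a\<^sub>0 < 0" using a0_le by simp
  \<comment> \<open>Dividing by the positive number \<open>- a\<^sub>0\<close> normalizes the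
    coefficient of the gain to -1.\<close>
  define \<zeta> where "\<zeta> = (1 / - a\<^sub>0) *\<^sub>R \<alpha>"
  show ?thesis
  proof (intro exI[of _ \<zeta>] conjI allI)
    show "\<zeta> $ i \<ge> 0" for i
      using \<alpha>_ge a0 by (simp add: \<zeta>_def divide_nonneg_neg divide_nonneg_nonpos divide_nonpos_neg)
    show "w \<bullet> u - (\<Sum>i\<in>UNIV. \<zeta> $ i * c i u) \<le> w \<bullet> v" for u
    proof -
      have "(\<Sum>i\<in>UNIV. \<zeta> $ i * c i u) = \<zeta> \<bullet> C u"
        by (simp add: C_def inner_vec_def)
      then have "a\<^sub>0 * (\<Sum>i\<in>UNIV. \<zeta> $ i * c i u) = - (\<alpha> \<bullet> C u)"
        using a0 by (simp add: \<zeta>_def)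
      then have "a\<^sub>0 * (w \<bullet> v) \<le> a\<^sub>0 * (w \<bullet> u - (\<Sum>i\<in>UNIV. \<zeta> $ i * c i u))"
        using key[of u] by (simp add: algebra_simps)
      then show ?thesis
        using a0 by (simp add: mult_le_cancel_left_neg)
    qed
  qed
qed

text \<open>From KKT to optimality, convexity bounds each constraint below by its tangent at
  \<open>u\<close>. Conversely, the multipliers given by Slater's condition make \<open>u\<close> an
  unconstrained maximizer of the Lagrangian, whose derivative therefore vanishes.\<close>

lemma kkt_set_iff_maximizer:
  fixes c :: "'l::finite \<Rightarrow> real ^ 'm \<Rightarrow> real"
  assumes poly: "\<And>i. real_polynomial_function (c i)"
    and conv: "\<And>i. convex_on UNIV (c i)"
    and slater: "\<exists>u\<^sub>0. \<forall>i. c i u\<^sub>0 < 0"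
  shows "(\<exists>\<zeta>. (u, \<zeta>) \<in> kkt_set g c b x \<theta>) \<longleftrightarrow>
    is_arg_max (\<lambda>v. lie_mat b g x \<theta> \<bullet> v) (\<lambda>v. v \<in> control_set c) u"
proof -
  define w where "w = lie_mat b g x \<theta>"
  have der: "(c i has_derivative (\<lambda>v. gradient (c i) y \<bullet> v)) (at y)" for i y
    using poly by (intro has_derivative_gradient differentiable_at_real_polynomial_function)
  show ?thesis
    unfolding w_def[symmetric]
  proof
    assume "\<exists>\<zeta>. (u, \<zeta>) \<in> kkt_set g c b x \<theta>"
    then obtain \<zeta> where k: "(u, \<zeta>) \<in> kkt_set g c b x \<theta>" by blast
    then have u: "\<And>i. c i u \<le> 0" and \<zeta>: "\<And>i. \<zeta> $ i \<ge> 0" and compl: "\<And>i. \<zeta> $ i * c i u = 0"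
      by (auto simp: kkt_set_def)
    have stat: "w = (\<Sum>i\<in>UNIV. \<zeta> $ i *\<^sub>R gradient (c i) u)"
      using k by (simp add: kkt_set_def w_def)
    have "w \<bullet> v \<le> w \<bullet> u" if v: "v \<in> control_set c" for v
    proof -
      have "w \<bullet> (v - u) = (\<Sum>i\<in>UNIV. \<zeta> $ i * (gradient (c i) u \<bullet> (v - u)))"
        by (simp add: stat inner_sum_left)
      also have "\<dots> \<le> (\<Sum>i\<in>UNIV. \<zeta> $ i * (c i v - c i u))"
        using convex_on_above_derivative[OF conv der, of _ u v] \<zeta>
        by (intro sum_mono mult_left_mono) (auto simp: algebra_simps)
      \<comment> \<open>Complementary slackness removes the terms at \<open>u\<close>; those at
        \<open>v\<close> are nonpositive by feasibility.\<close>
      also have "\<dots> \<le> 0"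
        unfolding right_diff_distrib compl
        using v \<zeta> by (intro sum_nonpos) (auto simp: control_set_def mult_nonneg_nonpos)
      finally show ?thesis by (simp add: inner_diff_right)
    qed
    then show "is_arg_max (\<lambda>v. w \<bullet> v) (\<lambda>v. v \<in> control_set c) u"
      using u by (auto simp: is_arg_max_def control_set_def not_less)
  next
    assume "is_arg_max (\<lambda>v. w \<bullet> v) (\<lambda>v. v \<in> control_set c) u"
    then have u: "\<And>i. c i u \<le> 0" and max: "\<And>v. (\<And>i. c i v \<le> 0) \<Longrightarrow> w \<bullet> v \<le> w \<bullet> u"
      by (auto simp: is_arg_max_def control_set_def not_less)
    obtain u\<^sub>0 where u\<^sub>0: "\<And>i. c i u\<^sub>0 < 0" using slater by blast
    have "\<exists>\<zeta> :: real ^ 'l. (\<forall>i. \<zeta> $ i \<ge> 0) \<and>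
        (\<forall>v. w \<bullet> v - (\<Sum>i\<in>UNIV. \<zeta> $ i * c i v) \<le> w \<bullet> u)"
      by (rule convex_lagrange_multipliers[OF conv u\<^sub>0]) (simp add: max)
    then obtain \<zeta> :: "real ^ 'l" where \<zeta>: "\<And>i. \<zeta> $ i \<ge> 0"
      and lag: "\<And>v. w \<bullet> v - (\<Sum>i\<in>UNIV. \<zeta> $ i * c i v) \<le> w \<bullet> u"
      by blast
    have np: "\<zeta> $ i * c i u \<le> 0" for i
      using \<zeta> u by (simp add: mult_nonneg_nonpos)
    \<comment> \<open>The Lagrangian bound at \<open>u\<close> itself makes the sum nonnegative,
      while all its terms are nonpositive.\<close>
    then have sum0: "(\<Sum>i\<in>UNIV. \<zeta> $ i * c i u) = 0"
      using lag[of u] sum_nonpos[of UNIV "\<lambda>i. \<zeta> $ i * c i u"] by fastforce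
    then have compl: "\<zeta> $ i * c i u = 0" for i
      using sum_nonneg_0[of UNIV "\<lambda>i. - (\<zeta> $ i * c i u)" i] np by (simp add: sum_negf)
    let ?L = "\<lambda>v. w \<bullet> v - (\<Sum>i\<in>UNIV. \<zeta> $ i * c i v)"
    let ?D = "\<lambda>v. w \<bullet> v - (\<Sum>i\<in>UNIV. \<zeta> $ i * (gradient (c i) u \<bullet> v))"
    have "(?L has_derivative ?D) (at u)"
      by (intro has_derivative_diff has_derivative_sum has_derivative_mult_right der
          has_derivative_inner_right has_derivative_ident)
    \<comment> \<open>By \<open>sum0\<close> the Lagrangian takes the value
      \<open>w \<bullet> u\<close> at \<open>u\<close>, so \<open>lag\<close> says that
      \<open>u\<close> maximizes it over the whole space.\<close>
    then have "?D = (\<lambda>v. 0)"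
      using lag sum0 by (intro differential_zero_maxmin[of u UNIV ?L]) auto
    then have "(w - (\<Sum>i\<in>UNIV. \<zeta> $ i *\<^sub>R gradient (c i) u)) \<bullet> v = 0" for v
      by (simp add: inner_diff_left inner_sum_left fun_eq_iff)
    then have "w - (\<Sum>i\<in>UNIV. \<zeta> $ i *\<^sub>R gradient (c i) u) = 0"
      by (metis inner_eq_zero_iff)
    then have "(u, \<zeta>) \<in> kkt_set g c b x \<theta>"
      using u \<zeta> compl by (auto simp: kkt_set_def w_def)
    then show "\<exists>\<zeta>. (u, \<zeta>) \<in> kkt_set g c b x \<theta>" by blast
  qed
qed

section \<open>Elimination of the disturbance\<close>

text \<open>Cauchy-Schwarz is sharp at the vector of length \<open>M\<close> opposite to
  \<open>v\<close>. For \<open>v = 0\<close> the convention \<open>sgn 0 = 0\<close> yields the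
  minimizer 0.\<close>

lemma is_arg_min_affine_cball:
  fixes v :: "'a::real_inner"
  assumes "M \<ge> 0"
  shows "is_arg_min (\<lambda>\<epsilon>. a + v \<bullet> \<epsilon>) (\<lambda>\<epsilon>. norm \<epsilon> \<le> M) (- M *\<^sub>R sgn v)"
    and "a + v \<bullet> (- M *\<^sub>R sgn v) = a - M * norm v"
proof -
  have "v \<bullet> sgn v = norm v"
    by (cases "v = 0") (simp_all add: sgn_div_norm power2_norm_eq_inner[symmetric] power2_eq_square)
  then show eq: "a + v \<bullet> (- M *\<^sub>R sgn v) = a - M * norm v" by simp
  have "a - M * norm v \<le> a + v \<bullet> \<epsilon>" if "norm \<epsilon> \<le> M" for \<epsilon>
  proof -
    have "- (v \<bullet> \<epsilon>) \<le> norm v * norm \<epsilon>"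
      using Cauchy_Schwarz_ineq2[of v \<epsilon>] by linarith
    also have "\<dots> \<le> M * norm v"
      using that by (simp add: mult.commute mult_right_mono)
    finally show ?thesis by linarith
  qed
  then show "is_arg_min (\<lambda>\<epsilon>. a + v \<bullet> \<epsilon>) (\<lambda>\<epsilon>. norm \<epsilon> \<le> M) (- M *\<^sub>R sgn v)"
    unfolding is_arg_min_def eq using assms by (auto simp: norm_sgn not_less)
qed

lemma INF_ereal_arg_min:
  assumes "is_arg_min h P x"
  shows "(INF y\<in>{y. P y}. ereal (h y)) = ereal (h x)"
  using assms by (intro antisym INF_lower INF_greatest) (auto simp: is_arg_min_linorder)

lemma worst_rate_eq:
  assumes "M \<ge> 0"
  shows "worst_rate f g J M b \<theta> x u =
    ereal (lie_vec b f x \<theta> + lie_mat b g x \<theta> \<bullet> u - M * norm (lie_mat b J x \<theta>))"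
  unfolding worst_rate_def
  using INF_ereal_arg_min[OF is_arg_min_affine_cball(1)[OF assms]]
  by (simp only: is_arg_min_affine_cball(2)[OF assms])

section \<open>Elimination of the control, and attainment of the outer minimum\<close>

text \<open>Real-valued, so that results on convex real functions apply; it is evaluated only where
  the supremum is attained.\<close>

definition support_function :: "'a::real_inner set \<Rightarrow> 'a \<Rightarrow> real"
  where "support_function U w = (SUP u\<in>U. w \<bullet> u)"

lemma support_function_eq:
  assumes "is_arg_max (\<lambda>u. w \<bullet> u) (\<lambda>u. u \<in> U) u"
  shows "support_function U w = w \<bullet> u"
  unfolding support_function_def
  using assms by (intro cSup_eq_maximum) (auto simp: is_arg_max_def not_less)

lemma compact_linear_arg_max:
  assumes "compact U" "U \<noteq> {}"
  obtains u where "is_arg_max (\<lambda>u. w \<bullet> u) (\<lambda>u. u \<in> U) u"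
proof -
  have "continuous_on U (\<lambda>u. w \<bullet> u)" by (intro continuous_intros)
  from continuous_attains_sup[OF assms this] show ?thesis
    using that by (auto simp: is_arg_max_def not_less)
qed

text \<open>A maximum of linear functionals is convex, and a finite convex function on a
  finite-dimensional space is continuous.\<close>

lemma continuous_on_support_function:
  fixes U :: "'a::euclidean_space set"
  assumes U: "compact U" "U \<noteq> {}"
  shows "continuous_on UNIV (support_function U)"
proof (rule convex_on_continuous)
  have le: "w \<bullet> u \<le> support_function U w" if "u \<in> U" for u w
    using compact_linear_arg_max[OF U] support_function_eq that
    by (metis is_arg_max_def not_less)
  show "convex_on UNIV (support_function U)"
  proof (rule convex_onI)
    fix t :: real and v w
    assume t: "0 < t" "t < 1"
    \<comment> \<open>A maximizer for the combined direction is merely a competitor for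
      \<open>v\<close> and for \<open>w\<close>.\<close>
    obtain u where u: "is_arg_max (\<lambda>u. ((1 - t) *\<^sub>R v + t *\<^sub>R w) \<bullet> u) (\<lambda>u. u \<in> U) u"
      using compact_linear_arg_max[OF U] .
    then have "support_function U ((1 - t) *\<^sub>R v + t *\<^sub>R w) = (1 - t) * (v \<bullet> u) + t * (w \<bullet> u)"
      by (simp add: support_function_eq inner_add_left)
    also have "\<dots> \<le> (1 - t) * support_function U v + t * support_function U w"
      using t le u by (intro add_mono mult_left_mono) (auto simp: is_arg_max_def)
    finally show "support_function U ((1 - t) *\<^sub>R v + t *\<^sub>R w) \<le> \<dots>" .
  qed simp
qed simp

text \<open>Once the disturbance is eliminated, the control enters only through the linear term, so
  a maximizer of that term is optimal.\<close>

lemma best_rate_eq: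
  assumes "M \<ge> 0" "compact (control_set c)" "control_set c \<noteq> {}"
  shows "best_rate f g J c M b \<theta> x = ereal (lie_vec b f x \<theta>
    + support_function (control_set c) (lie_mat b g x \<theta>) - M * norm (lie_mat b J x \<theta>))"
proof -
  obtain u where u: "is_arg_max (\<lambda>u. lie_mat b g x \<theta> \<bullet> u) (\<lambda>u. u \<in> control_set c) u"
    using compact_linear_arg_max[OF assms(2,3)] .
  show ?thesis
    unfolding best_rate_def worst_rate_eq[OF assms(1)] support_function_eq[OF u]
    using u by (intro antisym SUP_least SUP_upper) (auto simp: is_arg_max_def not_less)
qed

lemma continuous_on_section:
  assumes "real_polynomial_function (\<lambda>(x, \<theta>). h x \<theta>)"
  shows "continuous_on S (\<lambda>x. h x \<theta>)"
proof -
  have "continuous_on UNIV (\<lambda>(x, \<theta>). h x \<theta>)"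
    using assms by (simp add: continuous_on_polymonial_function real_polynomial_function_eq)
  then have "continuous_on S ((\<lambda>(x, \<theta>). h x \<theta>) \<circ> (\<lambda>x. (x, \<theta>)))"
    by (intro continuous_on_compose) (auto intro: continuous_intros continuous_on_subset)
  then show ?thesis by (simp add: o_def)
qed

text \<open>The zero set is closed in the compact superlevel set, and the best rate is continuous in
  the state because the support function is continuous.\<close>

lemma best_rate_arg_min:
  fixes c :: "'l \<Rightarrow> real ^ 'm \<Rightarrow> real"
  assumes f: "\<And>i. real_polynomial_function (\<lambda>x. f x $ i)"
    and g: "\<And>i j. real_polynomial_function (\<lambda>x. g x $ i $ j)"
    and J: "\<And>i j. real_polynomial_function (\<lambda>x. J x $ i $ j)"
    and U: "compact (control_set c)" "control_set c \<noteq> {}"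
    and M: "M \<ge> 0"
    and b: "real_polynomial_function (\<lambda>(x, \<theta>). b x \<theta>)"
    and cpt: "compact {x. b x \<theta> \<ge> 0}"
    and ne: "{x. b x \<theta> = 0} \<noteq> {}"
  obtains x where "is_arg_min (best_rate f g J c M b \<theta>) (\<lambda>x. b x \<theta> = 0) x"
proof -
  let ?r = "\<lambda>x. lie_vec b f x \<theta> + support_function (control_set c) (lie_mat b g x \<theta>)
    - M * norm (lie_mat b J x \<theta>)"
  \<comment> \<open>Continuity is shown by components, since polynomiality is known for
    these.\<close>
  have "continuous_on UNIV (\<lambda>x. \<chi> j. lie_mat b g x \<theta> $ j)"
    and "continuous_on UNIV (\<lambda>x. \<chi> j. lie_mat b J x \<theta> $ j)"
    by (intro continuous_on_vec_lambda continuous_on_section real_polynomial_function_lie_mat b g J)+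
  then have lie_mat_cont: "continuous_on UNIV (\<lambda>x. lie_mat b g x \<theta>)"
    "continuous_on UNIV (\<lambda>x. lie_mat b J x \<theta>)"
    by (simp_all only: vec_nth_inverse)
  have "continuous_on UNIV ?r"
    using lie_mat_cont continuous_on_section[OF real_polynomial_function_lie_vec[OF b f]]
    by (intro continuous_intros continuous_on_compose2[OF continuous_on_support_function[OF U]]) auto
  then have cont: "continuous_on {x. b x \<theta> = 0} ?r"
    by (rule continuous_on_subset) simp
  have "closed {x. b x \<theta> = 0}"
    using continuous_on_section[OF b, of UNIV \<theta>] by (intro closed_Collect_eq) auto
  then have "compact ({x. b x \<theta> \<ge> 0} \<inter> {x. b x \<theta> = 0})"
    by (rule compact_Int_closed[OF cpt])
  also have "{x. b x \<theta> \<ge> 0} \<inter> {x. b x \<theta> = 0} = {x. b x \<theta> = 0}" by auto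
  finally obtain x where "b x \<theta> = 0" "\<And>y. b y \<theta> = 0 \<Longrightarrow> ?r x \<le> ?r y"
    using continuous_attains_inf[OF _ ne cont] by auto
  then show ?thesis
    using that by (auto simp: is_arg_min_def best_rate_eq[OF M U] not_less)
qed

section \<open>Equality of the two values and of their maximizers\<close>

theorem mainTheorem1:
  fixes f :: "real ^ 'n \<Rightarrow> real ^ 'n"
    and g :: "real ^ 'n \<Rightarrow> real ^ 'm ^ 'n"
    and J :: "real ^ 'n \<Rightarrow> real ^ 'd ^ 'n"
    and c :: "'l::finite \<Rightarrow> real ^ 'm \<Rightarrow> real"
    and b :: "real ^ 'n \<Rightarrow> real ^ 'k \<Rightarrow> real"
    and M :: real
    and \<Theta> :: "(real ^ 'k) set"
  assumes "\<And>i. real_polynomial_function (\<lambda>x. f x $ i)"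
    and "\<And>i j. real_polynomial_function (\<lambda>x. g x $ i $ j)"
    and "\<And>i j. real_polynomial_function (\<lambda>x. J x $ i $ j)"
    and "compact (control_set c)"
    and "\<And>i. real_polynomial_function (c i)"
    and "\<And>i. convex_on UNIV (c i)"
    and "\<exists>u\<^sub>0. \<forall>i. c i u\<^sub>0 < 0"
    and "M \<ge> 0"
    and "compact \<Theta>"
    and "semialgebraic \<Theta>"
    and "real_polynomial_function (\<lambda>(x, \<theta>). b x \<theta>)"
    and "\<And>\<theta>. \<theta> \<in> \<Theta> \<Longrightarrow> compact {x. b x \<theta> \<ge> 0}"
  shows
    \<comment> \<open>the minima and maxima defining \<open>V\<close> and \<open>P\<close> are attained, except for the convention on the empty set\<close>
    "(\<forall>\<theta>\<in>\<Theta>.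
       (\<forall>x. b x \<theta> = 0 \<longrightarrow>
          (\<forall>u\<in>control_set c. \<exists>\<epsilon>. is_arg_min
             (\<lambda>\<epsilon>. lie_vec b f x \<theta> + lie_mat b g x \<theta> \<bullet> u + lie_mat b J x \<theta> \<bullet> \<epsilon>) (\<lambda>\<epsilon>. norm \<epsilon> \<le> M) \<epsilon>) \<and>
          (\<exists>u. is_arg_max (worst_rate f g J M b \<theta> x) (\<lambda>u. u \<in> control_set c) u)) \<and>
       ({x. b x \<theta> = 0} \<noteq> {} \<longrightarrow>
          (\<exists>x. is_arg_min (best_rate f g J c M b \<theta>) (\<lambda>x. b x \<theta> = 0) x) \<and>
          (\<exists>p. is_arg_min (P_objective f g M b \<theta>) (\<lambda>p. p \<in> P_feasible g J c b \<theta>) p))) \<and>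
     (\<forall>\<theta>\<in>\<Theta>. V_value f g J c M b \<theta> = P_value f g J c M b \<theta>) \<and>
     P_polynomial f g J c M b \<and>
     (SUP \<theta>\<in>\<Theta>. V_value f g J c M b \<theta>) = (SUP \<theta>\<in>\<Theta>. P_value f g J c M b \<theta>) \<and>
     {\<theta>. is_arg_max (V_value f g J c M b) (\<lambda>\<theta>. \<theta> \<in> \<Theta>) \<theta>} =
     {\<theta>. is_arg_max (P_value f g J c M b) (\<lambda>\<theta>. \<theta> \<in> \<Theta>) \<theta>}"
proof -
  note M = assms(8) and U = assms(4) and b = assms(11)
  obtain u\<^sub>0 where "\<And>i. c i u\<^sub>0 < 0" using assms(7) by blast
  then have "u\<^sub>0 \<in> control_set c" by (simp add: control_set_def less_imp_le)
  then have ne: "control_set c \<noteq> {}" by blast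
  note best = best_rate_eq[OF M U ne]
  note kkt = kkt_set_iff_maximizer[OF assms(5-7)]
  have inner: "\<exists>u. is_arg_max (worst_rate f g J M b \<theta> x) (\<lambda>u. u \<in> control_set c) u" for x \<theta>
    using compact_linear_arg_max[OF U ne, of "lie_mat b g x \<theta>"]
    by (auto simp: worst_rate_eq[OF M] is_arg_max_def not_less)
  \<comment> \<open>The sign of \<open>z\<close> is free, but both roots are at most the norm, so
    \<open>- M * z\<close> is at least the worst disturbance term.\<close>
  have lower: "best_rate f g J c M b \<theta> x \<le> ereal (P_objective f g M b \<theta> (x, z, u, \<zeta>))"
    if "(x, z, u, \<zeta>) \<in> P_feasible g J c b \<theta>" for x z u \<theta> and \<zeta> :: "real ^ 'l"
  proof -
    have z: "z\<^sup>2 = (norm (lie_mat b J x \<theta>))\<^sup>2" and "(u, \<zeta>) \<in> kkt_set g c b x \<theta>"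
      using that by (auto simp: P_feasible_def)
    then have "support_function (control_set c) (lie_mat b g x \<theta>) = lie_mat b g x \<theta> \<bullet> u"
      using kkt support_function_eq by blast
    moreover have "z \<le> norm (lie_mat b J x \<theta>)"
      by (rule power2_le_imp_le) (simp_all add: z)
    then have "M * z \<le> M * norm (lie_mat b J x \<theta>)" using M by (rule mult_left_mono)
    ultimately show ?thesis by (simp add: best P_objective_def)
  qed
  \<comment> \<open>A minimizing state for the best rate is completed to a minimizer of the
    single-level problem, with an inner maximizer, its multipliers and the nonnegative root
    \<open>z\<close>. One pair of witnesses thus gives both attainment and equality of the
    values.\<close>
  have attained: "\<exists>x p. is_arg_min (best_rate f g J c M b \<theta>) (\<lambda>x. b x \<theta> = 0) x \<and>
      is_arg_min (P_objective f g M b \<theta>) (\<lambda>p. p \<in> P_feasible g J c b \<theta>) p \<and>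
      best_rate f g J c M b \<theta> x = ereal (P_objective f g M b \<theta> p)"
    if \<theta>: "\<theta> \<in> \<Theta>" and S: "{x. b x \<theta> = 0} \<noteq> {}" for \<theta>
  proof -
    obtain x where x: "is_arg_min (best_rate f g J c M b \<theta>) (\<lambda>x. b x \<theta> = 0) x"
      using best_rate_arg_min[OF assms(1-3) U ne M b assms(12)[OF \<theta>] S] .
    obtain u where u: "is_arg_max (\<lambda>u. lie_mat b g x \<theta> \<bullet> u) (\<lambda>u. u \<in> control_set c) u"
      using compact_linear_arg_max[OF U ne] .
    then obtain \<zeta> where \<zeta>: "(u, \<zeta>) \<in> kkt_set g c b x \<theta>" using kkt by blast
    define p where "p = (x, norm (lie_mat b J x \<theta>), u, \<zeta>)"
    have p: "p \<in> P_feasible g J c b \<theta>"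
      using x \<zeta> by (simp add: p_def P_feasible_def is_arg_min_def)
    have eq: "best_rate f g J c M b \<theta> x = ereal (P_objective f g M b \<theta> p)"
      by (simp add: best support_function_eq[OF u] p_def P_objective_def)
    have "P_objective f g M b \<theta> p \<le> P_objective f g M b \<theta> q" if q: "q \<in> P_feasible g J c b \<theta>" for q
    proof -
      obtain y z v \<eta> where q_eq: "q = (y, z, v, \<eta>)" by (metis prod_cases4)
      have "best_rate f g J c M b \<theta> x \<le> best_rate f g J c M b \<theta> y"
        using x q by (auto simp: is_arg_min_linorder q_eq P_feasible_def)
      also have "\<dots> \<le> ereal (P_objective f g M b \<theta> q)"
        using lower q unfolding q_eq by blast
      finally show ?thesis by (simp add: eq)
    qed
    with p have "is_arg_min (P_objective f g M b \<theta>) (\<lambda>p. p \<in> P_feasible g J c b \<theta>) p"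
      by (simp add: is_arg_min_linorder)
    with x eq show ?thesis by blast
  qed
  have V_eq_P: "V_value f g J c M b \<theta> = P_value f g J c M b \<theta>" if \<theta>: "\<theta> \<in> \<Theta>" for \<theta>
  \<comment> \<open>With an empty zero set both infima are over the empty set, hence
    infinite.\<close>
  proof (cases "{x. b x \<theta> = 0} = {}")
    case True
    then have "P_feasible g J c b \<theta> = {}" by (auto simp: P_feasible_def)
    with True show ?thesis by (simp add: V_value_def P_value_def)
  next
    case False
    then obtain x p where x: "is_arg_min (best_rate f g J c M b \<theta>) (\<lambda>x. b x \<theta> = 0) x"
      and p: "is_arg_min (P_objective f g M b \<theta>) (\<lambda>p. p \<in> P_feasible g J c b \<theta>) p"
      and eq: "best_rate f g J c M b \<theta> x = ereal (P_objective f g M b \<theta> p)"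
      using attained[OF \<theta>] by blast
    have "V_value f g J c M b \<theta> = best_rate f g J c M b \<theta> x"
      unfolding V_value_def
      using x by (intro antisym INF_lower INF_greatest) (auto simp: is_arg_min_linorder)
    also have "\<dots> = P_value f g J c M b \<theta>"
      using INF_ereal_arg_min[OF p] by (simp add: eq P_value_def)
    finally show ?thesis .
  qed
  \<comment> \<open>Maximizers over \<open>\<Theta>\<close> compare values within
    \<open>\<Theta>\<close> only, where the two functions agree.\<close>
  then have argmax: "{\<theta>. is_arg_max (V_value f g J c M b) (\<lambda>\<theta>. \<theta> \<in> \<Theta>) \<theta>} =
      {\<theta>. is_arg_max (P_value f g J c M b) (\<lambda>\<theta>. \<theta> \<in> \<Theta>) \<theta>}"
    by (auto simp: is_arg_max_def)
  have sup: "(SUP \<theta>\<in>\<Theta>. V_value f g J c M b \<theta>) = (SUP \<theta>\<in>\<Theta>. P_value f g J c M b \<theta>)"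
    using V_eq_P by (intro SUP_cong) auto
  have poly: "P_polynomial f g J c M b"
    using assms(1-3,5) b by (rule P_polynomial_of_polynomial_data)
  show ?thesis
  proof (intro conjI ballI allI impI)
    show "\<exists>\<epsilon>. is_arg_min (\<lambda>\<epsilon>. lie_vec b f x \<theta> + lie_mat b g x \<theta> \<bullet> u + lie_mat b J x \<theta> \<bullet> \<epsilon>)
        (\<lambda>\<epsilon>. norm \<epsilon> \<le> M) \<epsilon>" for x u \<theta>
      by (rule exI) (rule is_arg_min_affine_cball(1)[OF M])
  next
    fix \<theta>
    assume "\<theta> \<in> \<Theta>" "{x. b x \<theta> = 0} \<noteq> {}"
    from attained[OF this]
    show "\<exists>x. is_arg_min (best_rate f g J c M b \<theta>) (\<lambda>x. b x \<theta> = 0) x"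
      and "\<exists>p. is_arg_min (P_objective f g M b \<theta>) (\<lambda>p. p \<in> P_feasible g J c b \<theta>) p"
      by iprover+
  qed (rule inner V_eq_P poly sup argmax, assumption?)+
qed

end
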